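(* Let $s\in\mathbb{N}\cup\{\infty\}$. Define recursively a sequence of universal polynomials $K_n(y,t_2,\dots,t_n)\in\boldsymbol{q}[y;t_2,\dots,t_n]$, for integers $n$ with $2\le n\le s$ (all $n\ge2$ if $s=\infty$), by $$ \begin{aligned} K_n(y,t_2,\dots,t_n)=\frac{1}{n-1}\Bigg(& t_n\sum_{j=0}^{n-2}y^j+\sum_{i=2}^{n-1}t_i\sum_{\overline{u}_n\in U_{n,i}}B_{\overline{u}_n}\,y^{u_1}(y^2-y)^{i-u_1-1}\prod_{j=2}^{n-i+1}K_j(y,t_2,\dots,t_j)^{u_j}\\ &-\sum_{i=2}^{n-1}t_i\,(n-i+1)\,K_{n-i+1}(y,t_2,\dots,t_{n-i+1})\Bigg). \end{aligned} $$ These are well-defined polynomials, and for every $H(x)=x+\sum_{n=2}^s h_nx^n\in\Gamma^s_1$ the following holds: for each $c_1\in\boldsymbol{k}^\star$, $$\Phi_{c_1}(x)=c_1x+\sum_{n=2}^s(c_1^2-c_1)\,K_n(c_1,h_2,\dots,h_n)\,x^n$$ is the unique solution of $(\mathrm{AJ}_s(H))$ with linear coefficient $c_1$. The family $\mathcal{S}(\mathrm{AJ}_s(H))$ of all solutions $\Phi_{c_1}$, $c_1\in\boldsymbol{k}^\star$, of $(\mathrm{AJ}_s(H))$ is a commutative group under substitution, isomorphic to $(\boldsymbol{k}^\star,\cdot)$.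
   Context: $\boldsymbol{k}$ is a field of characteristic $0$, $\boldsymbol{q}\subset\boldsymbol{k}$ its prime field (isomorphic to $\mathbb{Q}$), $\boldsymbol{k}^\star=\boldsymbol{k}\setminus\{0\}$. $\boldsymbol{k}[[x]]_\infty:=\boldsymbol{k}[[x]]$; for $s\in\mathbb{N}$, $\boldsymbol{k}[[x]]_s=\boldsymbol{k}[[x]]/(x^{s+1})$, with elements identified with polynomials $\sum_{j=0}^s c_jx^j$ and operations (including substitution) computed modulo $x^{s+1}$. $\Gamma^s$ is the group (under substitution $\circ$) of $f\in\boldsymbol{k}[[x]]_s$ of order exactly $1$, and $\Gamma^s_1=\{f\in\Gamma^s: f(x)\equiv x \bmod x^2\}$. $(\mathrm{AJ}_s(H))$ is the equation $(H\circ\Phi)(x)=\frac{d\Phi}{dx}\cdot H(x)$ (mod $x^{s+1}$ if $s<\infty$), and $\mathcal{S}(\mathrm{AJ}_s(H))$ is the set of its solutions $\Phi\in\Gamma^s$. For $1\le i\le n$, $$U_{n,i}=\Big\{\overline{u}_n=(u_1,\dots,u_n)\in\{0,1,\dots,i\}^n:\ \sum_{j=1}^n u_j=i,\ \sum_{j=1}^n j\,u_j=n\Big\},\qquad B_{\overline{u}_n}=\frac{i!}{\prod_{j=1}^n u_j!}\ \text{ for }\overline{u}_n\in U_{n,i}.$$ Empty sums are $0$ and empty products are $1$. *)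

theory Defs
  imports
    "HOL-Library.Poly_Mapping"
    "HOL-Library.FuncSet"
    "HOL-Library.Extended_Nat"
    "HOL-Computational_Algebra.Formal_Power_Series"
    "HOL-Algebra.Group"
begin

text \<open>
  For \<open>s = \<infinity>\<close> the ring below is the full power series ring, and for finite \<open>s\<close> it is the
  quotient by the ideal generated by the power \<open>s + 1\<close> of the indeterminate, each class being
  represented by its unique polynomial of degree at most \<open>s\<close>. Accordingly \<open>trunc s\<close> is the reduction
  onto representatives, and every operation is followed by it.
\<close>

definition trunc :: "enat \<Rightarrow> 'a::field_char_0 fps \<Rightarrow> 'a fps" where
  "trunc s f = Abs_fps (\<lambda>n. if enat n \<le> s then fps_nth f n else 0)"

definition series :: "enat \<Rightarrow> 'a::field_char_0 fps set" where
  "series s = {f. trunc s f = f}"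

text \<open>For \<open>s = 0\<close> there is no element of order exactly 1, so the carrier is empty.\<close>

definition Gamma :: "enat \<Rightarrow> ('a::field_char_0 fps) monoid" where
  "Gamma s =
    \<lparr>carrier = {f \<in> series s. f \<noteq> 0 \<and> subdegree f = 1},
     mult = (\<lambda>f g. trunc s (f oo g)),
     one = trunc s fps_X\<rparr>"

definition Gamma1 :: "enat \<Rightarrow> 'a::field_char_0 fps set" where
  "Gamma1 s = {f \<in> carrier (Gamma s). fps_X ^ 2 dvd f - fps_X}"

text \<open>
  The derivative is only determined modulo the \<open>s\<close>-th power of the indeterminate, but its product with
  the series \<open>H\<close> of order 1 is determined modulo the power \<open>s + 1\<close>.
\<close>

definition AJ :: "enat \<Rightarrow> 'a::field_char_0 fps \<Rightarrow> 'a fps \<Rightarrow> bool" where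
  "AJ s H \<Phi> \<longleftrightarrow> trunc s (H oo \<Phi>) = trunc s (fps_deriv \<Phi> * H)"

definition AJ_solutions :: "enat \<Rightarrow> 'a::field_char_0 fps \<Rightarrow> 'a fps set" where
  "AJ_solutions s H = {\<Phi> \<in> carrier (Gamma s). AJ s H \<Phi>}"

definition mult_group :: "('a::field_char_0) monoid" where
  "mult_group = \<lparr>carrier = UNIV - {0}, mult = (*), one = 1\<rparr>"

text \<open>
  The prime field of a field of characteristic 0 is the image of the embedding \<open>of_rat\<close>; polynomials
  over it are represented by polynomials over the rationals, as finitely supported maps from
  monomials to coefficients. The indeterminate \<open>T j\<close> is only used for \<open>j \<ge> 2\<close>.
\<close>

datatype indet = Y | T nat

type_synonym upoly = "(indet \<Rightarrow>\<^sub>0 nat) \<Rightarrow>\<^sub>0 rat"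

definition Const :: "rat \<Rightarrow> upoly" where
  "Const c = Poly_Mapping.single 0 c"

definition Var :: "indet \<Rightarrow> upoly" where
  "Var v = Poly_Mapping.single (Poly_Mapping.single v 1) 1"

definition poly_ring :: "indet set \<Rightarrow> upoly set" where
  "poly_ring V = {p. \<forall>m \<in> Poly_Mapping.keys p. Poly_Mapping.keys m \<subseteq> V}"

definition eval_upoly :: "(indet \<Rightarrow> 'a::field_char_0) \<Rightarrow> upoly \<Rightarrow> 'a" where
  "eval_upoly \<rho> p =
    (\<Sum>m\<in>Poly_Mapping.keys p. of_rat (Poly_Mapping.lookup p m) *
      (\<Prod>v\<in>Poly_Mapping.keys m. \<rho> v ^ Poly_Mapping.lookup m v))"

text \<open>A tuple of length \<open>n\<close> is a function on \<open>{1..n}\<close>, undefined elsewhere.\<close>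

definition U :: "nat \<Rightarrow> nat \<Rightarrow> (nat \<Rightarrow> nat) set" where
  "U n i = {u \<in> {1..n} \<rightarrow>\<^sub>E {0..i}. (\<Sum>j=1..n. u j) = i \<and> (\<Sum>j=1..n. j * u j) = n}"

definition B :: "nat \<Rightarrow> nat \<Rightarrow> (nat \<Rightarrow> nat) \<Rightarrow> rat" where
  "B n i u = fact i / (\<Prod>j=1..n. fact (u j))"

text \<open>
  The exponent \<open>i - u 1 - 1\<close> is a subtraction of natural numbers; that it never truncates is part
  of the well-definedness of the recursion. The value for \<open>n < 2\<close> is a dummy.
\<close>

function K :: "nat \<Rightarrow> upoly" where
  "K n = (if n < 2 then 0 else
     Const (1 / (of_nat n - 1)) *
      (Var (T n) * (\<Sum>j=0..n-2. Var Y ^ j)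
       + (\<Sum>i=2..n-1. Var (T i) *
            (\<Sum>u\<in>U n i. Const (B n i u) * Var Y ^ u 1 * (Var Y ^ 2 - Var Y) ^ (i - u 1 - 1) *
               (\<Prod>j=2..n-i+1. K j ^ u j)))
       - (\<Sum>i=2..n-1. Var (T i) * of_nat (n - i + 1) * K (n - i + 1))))"
  by pat_completeness auto
termination
  by (relation "measure id") auto

declare K.simps [simp del]

definition K_at :: "nat \<Rightarrow> 'a::field_char_0 \<Rightarrow> (nat \<Rightarrow> 'a) \<Rightarrow> 'a" where
  "K_at n c h = eval_upoly (case_indet c h) (K n)"

definition Phi :: "enat \<Rightarrow> 'a::field_char_0 fps \<Rightarrow> 'a \<Rightarrow> 'a fps" where
  "Phi s H c = Abs_fps (\<lambda>n.
     if n = 1 then c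
     else if 2 \<le> n \<and> enat n \<le> s then (c ^ 2 - c) * K_at n c (fps_nth H)
     else 0)"

end

theory Submission
  imports Defs
begin

unbundle fps_syntax

text \<open>
  Write \<open>H = x + \<Sum> h\<^sub>n x\<^sup>n\<close> and \<open>\<Phi> = c x + \<Sum> \<phi>\<^sub>n x\<^sup>n\<close>. In the coefficient of \<open>x\<^sup>n\<close>, the equation
  \<open>H \<circ> \<Phi> = \<Phi>' H\<close> contains \<open>\<phi>\<^sub>n\<close> once on the left and \<open>n\<close> times on the right, because the linear
  coefficient of \<open>H\<close> is 1; all other terms involve only \<open>\<phi>\<^sub>j\<close> with \<open>j < n\<close>. So the equation amounts
  to a recursion for \<open>(n - 1) \<phi>\<^sub>n\<close>, with no condition for \<open>n = 0, 1\<close> (\<open>AJ_iff_recursion\<close>). As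
  \<open>n - 1\<close> is invertible for \<open>n \<ge> 2\<close>, the linear coefficient \<open>c\<close> determines the solution
  (\<open>AJ_solution_unique\<close>).

  For existence, the coefficients of \<open>\<Phi>\<^sup>i\<close> are expanded by the multinomial theorem
  (\<open>fps_power_nth_multinomial\<close>), which is where the index sets \<open>U n i\<close> come from. Put
  \<open>\<phi>\<^sub>j = (c\<^sup>2 - c) K\<^sub>j\<close> for \<open>j \<ge> 2\<close>. Every term of the recursion is then divisible by \<open>c\<^sup>2 - c\<close>:
  \<open>c\<^sup>n - c\<close> is, by the geometric sum; the lower coefficients \<open>\<phi>\<^sub>j\<close> are; and a monomial indexed by
  \<open>u \<in> U n i\<close> with \<open>2 \<le> i < n\<close> has \<open>i - u\<^sub>1 \<ge> 1\<close> factors \<open>\<phi>\<^sub>j\<close> with \<open>j \<ge> 2\<close> (\<open>U_first_less\<close>).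
  Removing one factor \<open>c\<^sup>2 - c\<close> leaves exactly the recursion that defines \<open>K\<^sub>n\<close>, and multiplying it
  back in is legitimate even when \<open>c = 1\<close> (\<open>Phi_solution\<close>). Evaluating the recursion at \<open>c\<close> and the
  \<open>h\<^sub>j\<close> uses that \<open>eval_upoly\<close> is a ring homomorphism.

  The chain rule shows that solutions are closed under substitution, and linear coefficients
  multiply (\<open>AJ_solutions_compose\<close>). By uniqueness, \<open>\<Phi>\<^sub>c \<circ> \<Phi>\<^sub>d = \<Phi>\<^sub>c\<^sub>d\<close>, so \<open>c \<mapsto> \<Phi>\<^sub>c\<close> is a
  multiplicative bijection from the nonzero scalars onto the solutions. It transports the group
  laws, inverses and commutativity included.
\<close>

section \<open>Polynomials with rational coefficients and their values\<close>

definition monom_value :: "(indet \<Rightarrow> 'a::field_char_0) \<Rightarrow> (indet \<Rightarrow>\<^sub>0 nat) \<Rightarrow> 'a" where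
  "monom_value \<rho> m = (\<Prod>v\<in>Poly_Mapping.keys m. \<rho> v ^ Poly_Mapping.lookup m v)"

lemma monom_value_superset:
  assumes "finite V" "Poly_Mapping.keys m \<subseteq> V"
  shows "monom_value \<rho> m = (\<Prod>v\<in>V. \<rho> v ^ Poly_Mapping.lookup m v)"
  unfolding monom_value_def
  by (rule prod.mono_neutral_left) (use assms in \<open>auto simp: in_keys_iff\<close>)

lemma monom_value_add: "monom_value \<rho> (m + m') = monom_value \<rho> m * monom_value \<rho> m'"
proof -
  let ?V = "Poly_Mapping.keys m \<union> Poly_Mapping.keys m'"
  have "monom_value \<rho> (m + m') = (\<Prod>v\<in>?V. \<rho> v ^ Poly_Mapping.lookup (m + m') v)"
    by (rule monom_value_superset) (auto dest: subsetD[OF Poly_Mapping.keys_add])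
  also have "\<dots> = (\<Prod>v\<in>?V. \<rho> v ^ Poly_Mapping.lookup m v) * (\<Prod>v\<in>?V. \<rho> v ^ Poly_Mapping.lookup m' v)"
    by (simp add: lookup_add power_add prod.distrib)
  also have "\<dots> = monom_value \<rho> m * monom_value \<rho> m'"
    by (simp add: monom_value_superset[of ?V])
  finally show ?thesis .
qed

text \<open>
  Supports shrink when terms cancel, so polynomials are evaluated over a common finite set of
  monomials, on which addition is termwise.
\<close>

lemma eval_upoly_superset:
  assumes "finite M" "Poly_Mapping.keys p \<subseteq> M"
  shows "eval_upoly \<rho> p = (\<Sum>m\<in>M. of_rat (Poly_Mapping.lookup p m) * monom_value \<rho> m)"
  unfolding eval_upoly_def monom_value_def[symmetric]
  by (rule sum.mono_neutral_left) (use assms in \<open>auto simp: in_keys_iff\<close>)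

lemma eval_upoly_add: "eval_upoly \<rho> (p + q) = eval_upoly \<rho> p + eval_upoly \<rho> q"
proof -
  let ?M = "Poly_Mapping.keys p \<union> Poly_Mapping.keys q"
  have "eval_upoly \<rho> (p + q) = (\<Sum>m\<in>?M. of_rat (Poly_Mapping.lookup (p + q) m) * monom_value \<rho> m)"
    by (rule eval_upoly_superset) (auto dest: subsetD[OF Poly_Mapping.keys_add])
  also have "\<dots> = eval_upoly \<rho> p + eval_upoly \<rho> q"
    by (simp add: eval_upoly_superset[of ?M] lookup_add of_rat_add algebra_simps sum.distrib)
  finally show ?thesis .
qed

lemma eval_upoly_0 [simp]: "eval_upoly \<rho> 0 = 0"
  by (simp add: eval_upoly_def)

lemma eval_upoly_diff: "eval_upoly \<rho> (p - q) = eval_upoly \<rho> p - eval_upoly \<rho> q"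
  using eval_upoly_add[of \<rho> "p - q" q] by simp

lemma eval_upoly_single: "eval_upoly \<rho> (Poly_Mapping.single m a) = of_rat a * monom_value \<rho> m"
  by (subst eval_upoly_superset[of "{m}"]) auto

lemma eval_upoly_sum: "eval_upoly \<rho> (\<Sum>x\<in>A. f x) = (\<Sum>x\<in>A. eval_upoly \<rho> (f x))"
  by (induction A rule: infinite_finite_induct) (auto simp: eval_upoly_add)

lemma upoly_eq_sum_single:
  "p = (\<Sum>m\<in>Poly_Mapping.keys p. Poly_Mapping.single m (Poly_Mapping.lookup p m))"
  by (rule poly_mapping_eqI)
     (auto simp: lookup_sum lookup_single when_def in_keys_iff)

text \<open>
  A polynomial is the sum of its terms, so multiplicativity reduces to that of monomials.
\<close>

lemma eval_upoly_mult: "eval_upoly \<rho> (p * q) = eval_upoly \<rho> p * eval_upoly \<rho> q"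
proof -
  have "p * q = (\<Sum>m\<in>Poly_Mapping.keys p. \<Sum>m'\<in>Poly_Mapping.keys q.
      Poly_Mapping.single (m + m') (Poly_Mapping.lookup p m * Poly_Mapping.lookup q m'))"
    by (subst upoly_eq_sum_single[of p], subst upoly_eq_sum_single[of q])
       (simp add: sum_product mult_single)
  then show ?thesis
    by (simp add: eval_upoly_sum eval_upoly_single monom_value_add of_rat_mult
          eval_upoly_superset[OF _ subset_refl] sum_product mult_ac)
qed

lemma eval_upoly_Const [simp]: "eval_upoly \<rho> (Const a) = of_rat a"
  by (simp add: Const_def eval_upoly_single monom_value_def)

lemma eval_upoly_Var [simp]: "eval_upoly \<rho> (Var v) = \<rho> v"
  by (simp add: Var_def eval_upoly_single monom_value_def)

lemma eval_upoly_1 [simp]: "eval_upoly \<rho> 1 = 1"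
  using eval_upoly_Const[of \<rho> 1] by (simp add: Const_def)

lemma eval_upoly_power: "eval_upoly \<rho> (p ^ n) = eval_upoly \<rho> p ^ n"
  by (induction n) (auto simp: eval_upoly_mult)

lemma eval_upoly_prod: "eval_upoly \<rho> (\<Prod>x\<in>A. f x) = (\<Prod>x\<in>A. eval_upoly \<rho> (f x))"
  by (induction A rule: infinite_finite_induct) (auto simp: eval_upoly_mult)

lemma eval_upoly_of_nat [simp]: "eval_upoly \<rho> (of_nat n) = of_nat n"
  by (induction n) (auto simp: eval_upoly_add)

lemmas eval_upoly_hom = eval_upoly_add eval_upoly_diff eval_upoly_mult eval_upoly_sum
  eval_upoly_prod eval_upoly_power

lemma poly_ring_mono: "V \<subseteq> V' \<Longrightarrow> p \<in> poly_ring V \<Longrightarrow> p \<in> poly_ring V'"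
  unfolding poly_ring_def by blast

lemma poly_ring_add: "p \<in> poly_ring V \<Longrightarrow> q \<in> poly_ring V \<Longrightarrow> p + q \<in> poly_ring V"
  unfolding poly_ring_def using Poly_Mapping.keys_add[of p q] by blast

lemma poly_ring_diff: "p \<in> poly_ring V \<Longrightarrow> q \<in> poly_ring V \<Longrightarrow> p - q \<in> poly_ring V"
  unfolding poly_ring_def using Poly_Mapping.keys_diff[of p q] by blast

lemma poly_ring_mult: "p \<in> poly_ring V \<Longrightarrow> q \<in> poly_ring V \<Longrightarrow> p * q \<in> poly_ring V"
  unfolding poly_ring_def
  by (fastforce dest!: subsetD[OF Poly_Mapping.keys_mult] subsetD[OF Poly_Mapping.keys_add])

lemma poly_ring_Const: "Const a \<in> poly_ring V"
  by (auto simp: poly_ring_def Const_def)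

lemma poly_ring_Var: "v \<in> V \<Longrightarrow> Var v \<in> poly_ring V"
  by (auto simp: poly_ring_def Var_def)

lemma poly_ring_0: "0 \<in> poly_ring V"
  by (auto simp: poly_ring_def)

lemma poly_ring_1: "1 \<in> poly_ring V"
  using poly_ring_Const[of 1] by (simp add: Const_def)

lemma poly_ring_power: "p \<in> poly_ring V \<Longrightarrow> p ^ n \<in> poly_ring V"
  by (induction n) (auto intro: poly_ring_1 poly_ring_mult)

lemma poly_ring_of_nat: "of_nat n \<in> poly_ring V"
  by (induction n) (auto intro: poly_ring_0 poly_ring_1 poly_ring_add)

lemma poly_ring_sum: "(\<And>x. x \<in> A \<Longrightarrow> f x \<in> poly_ring V) \<Longrightarrow> (\<Sum>x\<in>A. f x) \<in> poly_ring V"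
  by (induction A rule: infinite_finite_induct) (auto intro: poly_ring_0 poly_ring_add)

lemma poly_ring_prod: "(\<And>x. x \<in> A \<Longrightarrow> f x \<in> poly_ring V) \<Longrightarrow> (\<Prod>x\<in>A. f x) \<in> poly_ring V"
  by (induction A rule: infinite_finite_induct) (auto intro: poly_ring_1 poly_ring_mult)

lemmas poly_ring_closed = poly_ring_add poly_ring_diff poly_ring_mult poly_ring_Const
  poly_ring_Var poly_ring_power poly_ring_of_nat poly_ring_sum poly_ring_prod

lemma K_in_poly_ring: "K n \<in> poly_ring (insert Y (T ` {2..n}))"
proof (induction n rule: less_induct)
  case (less n)
  have IH: "K j \<in> poly_ring (insert Y (T ` {2..n}))" if "j < n" for j
    by (rule poly_ring_mono[OF _ less[OF that]]) (use that in auto)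
  show ?case
    by (subst K.simps, simp only: of_nat_Suc split: if_split, intro conjI impI poly_ring_closed poly_ring_0 IH) auto
qed

section \<open>The index sets\<close>

lemma U_sum_head:
  assumes "u \<in> U n i" "n \<ge> 1"
  shows "u 1 + (\<Sum>j=2..n. u j) = i" "u 1 + (\<Sum>j=2..n. j * u j) = n"
proof -
  have *: "{1..n} = insert 1 {2..n}"
    using assms(2) by auto
  show "u 1 + (\<Sum>j=2..n. u j) = i" "u 1 + (\<Sum>j=2..n. j * u j) = n"
    using assms(1) unfolding U_def * by auto
qed

text \<open>
  If all \<open>i\<close> parts were equal to 1, their sum \<open>n\<close> would be \<open>i\<close>.
\<close>

lemma U_first_less:
  assumes "u \<in> U n i" "i < n"
  shows "u 1 < i"
proof (rule ccontr)
  assume "\<not> u 1 < i"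
  with U_sum_head(1)[OF assms(1)] assms(2) have "(\<Sum>j=2..n. u j) = 0" "u 1 = i"
    by auto
  then have "(\<Sum>j=2..n. j * u j) = 0"
    by simp
  with U_sum_head(2)[OF assms(1)] assms(2) \<open>u 1 = i\<close> show False
    by simp
qed

text \<open>
  Subtracting the two equations that define \<open>U n i\<close> gives \<open>\<Sum> (j - 1) u\<^sub>j = n - i\<close>. Hence an index
  with \<open>j - 1 > n - i\<close> cannot occur. For \<open>i \<ge> 2\<close> this excludes \<open>j = n\<close>, which is what makes the
  recursion for the coefficients of a solution a recursion.
\<close>

lemma U_eq_0:
  assumes "u \<in> U n i" "j \<in> {1..n}" "n + 1 < i + j"
  shows "u j = 0"
proof -
  have "(\<Sum>j=1..n. j * u j) = (\<Sum>j=1..n. u j) + (\<Sum>j=1..n. (j - 1) * u j)"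
    unfolding sum.distrib[symmetric] by (rule sum.cong) (auto simp: algebra_simps)
  then have "n = i + (\<Sum>j=1..n. (j - 1) * u j)"
    using assms(1) by (simp add: U_def)
  moreover have "(j - 1) * u j \<le> (\<Sum>j=1..n. (j - 1) * u j)"
    by (rule member_le_sum[of j "{1..n}" "\<lambda>j. (j - 1) * u j"]) (use assms in auto)
  ultimately have "i + (j - 1) * u j \<le> n"
    by linarith
  moreover have "j - 1 \<le> (j - 1) * u j" if "u j > 0"
    using that by simp
  ultimately have "i + (j - 1) \<le> n" if "u j > 0"
    using that by linarith
  then show ?thesis
    using assms(2,3) by (cases "u j = 0") auto
qed

section \<open>Coefficients of powers of a power series\<close>

lemma of_rat_fact: "(of_rat (fact n) :: 'a::field_char_0) = fact n"
  by (metis of_nat_fact of_rat_of_nat_eq)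

text \<open>
  These are the index sets of the multinomial theorem. Keeping the index set \<open>A\<close> general allows
  induction on it; the second equation of \<open>U n i\<close>, which weights the parts, is imposed only
  afterwards, when a single coefficient is extracted.
\<close>

definition compositions :: "'b set \<Rightarrow> nat \<Rightarrow> ('b \<Rightarrow> nat) set" where
  "compositions A i = {u \<in> A \<rightarrow>\<^sub>E {0..i}. (\<Sum>j\<in>A. u j) = i}"

lemma finite_compositions: "finite A \<Longrightarrow> finite (compositions A i)"
  unfolding compositions_def by (rule finite_subset[of _ "A \<rightarrow>\<^sub>E {0..i}"]) (auto intro: finite_PiE)

lemma compositions_iff:
  assumes "finite A"
  shows "u \<in> compositions A i \<longleftrightarrow> u \<in> extensional A \<and> (\<Sum>j\<in>A. u j) = i"
  using member_le_sum[OF _ _ assms, of _ u] by (auto simp: compositions_def PiE_iff)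

lemma sum_compositions_insert:
  fixes g :: "('b \<Rightarrow> nat) \<Rightarrow> 'c::comm_monoid_add"
  assumes "finite A" "a \<notin> A"
  shows "(\<Sum>u\<in>compositions (insert a A) i. g u) =
    (\<Sum>k\<le>i. \<Sum>u\<in>compositions A (i - k). g (u(a := k)))"
proof -
  have upd: "(\<Sum>j\<in>A. (u(a := k)) j) = (\<Sum>j\<in>A. u j)" for u :: "'b \<Rightarrow> nat" and k
    by (rule sum.cong) (use assms in auto)
  have "(\<Sum>u\<in>compositions (insert a A) i. g u) =
      (\<Sum>(k, u)\<in>(SIGMA k:{..i}. compositions A (i - k)). g (u(a := k)))"
  proof (rule sum.reindex_bij_witness[where i = "\<lambda>(k, u). u(a := k)"
          and j = "\<lambda>u. (u a, u(a := undefined))"], goal_cases)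
    case (2 u)
    then have "sum u A = i - u a" "u a \<le> i" "u(a := undefined) \<in> extensional A"
      using assms by (auto simp: compositions_iff extensional_def)
    then show ?case
      using assms by (simp add: compositions_iff upd del: fun_upd_apply)
  next
    case (4 ku)
    then obtain k u where ku: "ku = (k, u)" "k \<le> i" "u \<in> extensional A" "sum u A = i - k"
      using assms by (auto simp: compositions_iff)
    then have "sum (u(a := k)) (insert a A) = i"
      using assms by (simp add: upd del: fun_upd_apply) simp
    moreover have "u(a := k) \<in> extensional (insert a A)"
      using ku by (auto simp: extensional_def)
    ultimately show ?case
      using assms ku by (simp add: compositions_iff del: fun_upd_apply)
  next
    case (3 ku)
    then show ?case
      using assms by (auto simp: compositions_iff extensional_def fun_eq_iff)
  qed auto
  also have "\<dots> = (\<Sum>k\<le>i. \<Sum>u\<in>compositions A (i - k). g (u(a := k)))"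
    by (rule sum.Sigma[symmetric]) (use assms in \<open>auto simp: finite_compositions\<close>)
  finally show ?thesis .
qed

lemma fps_const_fact_choose:
  assumes "k \<le> i"
  shows "fps_const (1 / fact i) * of_nat (i choose k) =
        fps_const (1 / fact k) * fps_const (1 / fact (i - k) :: 'a::field_char_0)"
proof -
  have "(1 / fact i) * of_nat (i choose k) = (1 / fact k) * (1 / fact (i - k) :: 'a)"
    using assms by (simp add: binomial_fact)
  then show ?thesis
    by (simp only: fps_of_nat[symmetric] fps_const_mult)
qed

text \<open>
  The divided powers \<open>f\<^sup>i / i!\<close> satisfy a binomial theorem without coefficients. Induction on the
  number of summands then gives the multinomial theorem in the form \<open>divided_power_sum\<close>, with no
  identities between multinomial coefficients.
\<close>

lemma divided_power_add:
  fixes f g :: "'a::field_char_0 fps"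
  shows "fps_const (1 / fact i) * (f + g) ^ i =
    (\<Sum>k\<le>i. fps_const (1 / fact k) * f ^ k * (fps_const (1 / fact (i - k)) * g ^ (i - k)))"
proof -
  have "fps_const (1 / fact i) * (of_nat (i choose k) * f ^ k * g ^ (i - k)) =
      fps_const (1 / fact k) * f ^ k * (fps_const (1 / fact (i - k)) * g ^ (i - k))" if "k \<le> i" for k
  proof -
    have "fps_const (1 / fact i) * (of_nat (i choose k) * f ^ k * g ^ (i - k)) = (fps_const (1 / fact i) * of_nat (i choose k)) * (f ^ k * g ^ (i - k))"
      by (simp only: mult.assoc)
    also have "\<dots> = fps_const (1 / fact k) * f ^ k * (fps_const (1 / fact (i - k)) * g ^ (i - k))"
      unfolding fps_const_fact_choose[OF that] by (simp only: mult_ac)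
    finally show ?thesis .
  qed
  then show ?thesis
    unfolding binomial_ring sum_distrib_left by (intro sum.cong) (simp_all only: refl atMost_iff)
qed

lemma divided_power_sum:
  fixes f :: "'b \<Rightarrow> 'a::field_char_0 fps"
  assumes "finite A"
  shows "fps_const (1 / fact i) * (\<Sum>j\<in>A. f j) ^ i =
    (\<Sum>u\<in>compositions A i. \<Prod>j\<in>A. fps_const (1 / fact (u j)) * f j ^ u j)"
  using assms
proof (induction A arbitrary: i rule: finite_induct)
  case empty
  have "compositions {} i = (if i = 0 then {\<lambda>_. undefined} else {} :: ('b \<Rightarrow> nat) set)"
    by (auto simp: compositions_def)
  then show ?case
    by simp
next
  case (insert a A)
  have upd: "(\<Prod>j\<in>A. fps_const (1 / fact ((u(a := k)) j)) * f j ^ (u(a := k)) j) =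
      (\<Prod>j\<in>A. fps_const (1 / fact (u j)) * f j ^ u j)" for u :: "'b \<Rightarrow> nat" and k
    by (rule prod.cong) (use insert.hyps in auto)
  show ?case
    using insert.hyps
    by (simp add: divided_power_add insert.IH sum_compositions_insert upd sum_distrib_left
          del: fun_upd_apply) 
       (simp add: upd)
qed

lemma fps_power_nth_cong:
  fixes f g :: "'a::comm_ring_1 fps"
  assumes "\<And>m. m \<le> n \<Longrightarrow> f $ m = g $ m" "m \<le> n"
  shows "(f ^ i) $ m = (g ^ i) $ m"
  using assms(2)
proof (induction i arbitrary: m)
  case (Suc i)
  then show ?case
    by (auto simp: fps_mult_nth assms(1) intro!: sum.cong)
qed simp

text \<open>
  The coefficient does not change when \<open>\<Phi>\<close> is cut off after degree \<open>n\<close>, which leaves a finite sum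
  of monomials. In its multinomial expansion the term of \<open>u\<close> has degree \<open>\<Sum> j u\<^sub>j\<close>, so the terms
  that contribute are those with \<open>u \<in> U n i\<close>.
\<close>

lemma fps_power_nth_multinomial:
  fixes \<Phi> :: "'a::field_char_0 fps"
  assumes "\<Phi> $ 0 = 0"
  shows "(\<Phi> ^ i) $ n = (\<Sum>u\<in>U n i. of_rat (B n i u) * (\<Prod>j=1..n. (\<Phi> $ j) ^ u j))"
proof -
  \<comment> \<open>the part of \<open>\<Phi>\<close> that the coefficient depends on\<close>
  define P where "P = (\<Sum>j=1..n. fps_const (\<Phi> $ j) * fps_X ^ j)"
  have P: "\<Phi> $ m = P $ m" if "m \<le> n" for m
    using that assms by (cases "m = 0") (auto simp: P_def fps_sum_nth fps_X_power_iff if_distrib cong: if_cong)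
  have term_eq: "(\<Prod>j=1..n. fps_const (1 / fact (u j)) * (fps_const (\<Phi> $ j) * fps_X ^ j) ^ u j) =
      fps_const (\<Prod>j=1..n. (\<Phi> $ j) ^ u j / fact (u j)) * fps_X ^ (\<Sum>j=1..n. j * u j)" for u
  proof -
    have "(\<Prod>j\<in>A. fps_const (1 / fact (u j)) * (fps_const (\<Phi> $ j) * fps_X ^ j) ^ u j) =
      fps_const (\<Prod>j\<in>A. (\<Phi> $ j) ^ u j / fact (u j)) * fps_X ^ (\<Sum>j\<in>A. j * u j)" if "finite A" for A
      using that
    proof (induction A rule: finite_induct)
      case (insert j A)
      then show ?case
        by (simp add: power_mult_distrib power_add power_mult fps_const_power
            flip: fps_const_mult) (simp add: mult_ac flip: fps_const_mult_left)
    qed simp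
    then show ?thesis
      by simp
  qed
  have U: "U n i = {u \<in> compositions {1..n} i. (\<Sum>j=1..n. j * u j) = n}"
    by (auto simp: U_def compositions_def)
  have "(\<Phi> ^ i) $ n / fact i = (fps_const (1 / fact i) * P ^ i) $ n"
    using fps_power_nth_cong[OF P, of n n i] by simp
  also have "\<dots> = (\<Sum>u\<in>compositions {1..n} i.
      (fps_const (\<Prod>j=1..n. (\<Phi> $ j) ^ u j / fact (u j)) * fps_X ^ (\<Sum>j=1..n. j * u j)) $ n)"
    unfolding P_def by (subst divided_power_sum) (simp_all only: term_eq fps_sum_nth finite_atLeastAtMost)
  also have "\<dots> = (\<Sum>u\<in>compositions {1..n} i. if (\<Sum>j=1..n. j * u j) = n
      then (\<Prod>j=1..n. (\<Phi> $ j) ^ u j / fact (u j)) else 0)"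
    by (intro sum.cong) (auto simp: fps_X_power_iff)
  also have "\<dots> = (\<Sum>u\<in>U n i. (\<Prod>j=1..n. (\<Phi> $ j) ^ u j / fact (u j)))"
    unfolding U by (rule sum.inter_filter[symmetric]) (simp add: finite_compositions)
  finally have "(\<Phi> ^ i) $ n = (\<Sum>u\<in>U n i. fact i * (\<Prod>j=1..n. (\<Phi> $ j) ^ u j / fact (u j)))"
    by (simp add: field_simps sum_distrib_left)
  also have "\<dots> = (\<Sum>u\<in>U n i. of_rat (B n i u) * (\<Prod>j=1..n. (\<Phi> $ j) ^ u j))"
    by (intro sum.cong) (auto simp: B_def of_rat_divide of_rat_prod of_rat_fact prod_dividef)
  finally show ?thesis .
qed

section \<open>Truncation\<close>

lemma trunc_nth: "trunc s f $ n = (if enat n \<le> s then f $ n else 0)"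
  by (simp add: trunc_def)

lemma trunc_eq_iff: "trunc s f = trunc s g \<longleftrightarrow> (\<forall>n. enat n \<le> s \<longrightarrow> f $ n = g $ n)"
  by (auto simp: fps_eq_iff trunc_nth)

lemma trunc_trunc [simp]: "trunc s (trunc s f) = trunc s f"
  by (simp add: trunc_eq_iff trunc_nth)

lemma trunc_mult_cong:
  assumes "trunc s f = trunc s f'" "trunc s g = trunc s g'"
  shows "trunc s (f * g) = trunc s (f' * g')"
  unfolding trunc_eq_iff fps_mult_nth
proof (intro allI impI sum.cong refl)
  fix n i assume *: "enat n \<le> s" "i \<in> {0..n}"
  then have "enat i \<le> s" "enat (n - i) \<le> s"
    by (auto intro: order_trans[rotated])
  then show "f $ i * g $ (n - i) = f' $ i * g' $ (n - i)"
    using assms by (simp add: trunc_eq_iff)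
qed

lemma trunc_compose_cong:
  assumes "trunc s f = trunc s f'" "trunc s g = trunc s g'"
  shows "trunc s (f oo g) = trunc s (f' oo g')"
  unfolding trunc_eq_iff fps_compose_nth
proof (intro allI impI sum.cong refl)
  fix n i assume *: "enat n \<le> s" "i \<in> {0..n}"
  then have le: "enat m \<le> s" if "m \<le> n" for m
    using that by (auto intro: order_trans[rotated])
  have "(g ^ i) $ n = (g' ^ i) $ n"
    by (rule fps_power_nth_cong[of n]) (use assms le in \<open>auto simp: trunc_eq_iff\<close>)
  then show "f $ i * (g ^ i) $ n = f' $ i * (g' ^ i) $ n"
    using assms le * by (simp add: trunc_eq_iff)
qed

text \<open>
  Differentiation loses one order of precision, and multiplication by a series without constant
  term regains it.
\<close>

lemma trunc_deriv_mult_cong: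
  assumes "trunc s f = trunc s g" "H $ 0 = 0"
  shows "trunc s (fps_deriv f * H) = trunc s (fps_deriv g * H)"
  unfolding trunc_eq_iff fps_mult_nth
proof (intro allI impI sum.cong refl)
  fix n i assume *: "enat n \<le> s" "i \<in> {0..n}"
  show "fps_deriv f $ i * H $ (n - i) = fps_deriv g $ i * H $ (n - i)"
  proof (cases "i = n")
    case False
    with * have "enat (Suc i) \<le> s"
      by (auto intro: order_trans[rotated])
    then show ?thesis
      using assms by (simp add: trunc_eq_iff)
  qed (simp add: assms)
qed

lemma Gamma_iff:
  "f \<in> carrier (Gamma s) \<longleftrightarrow> f $ 0 = 0 \<and> f $ 1 \<noteq> 0 \<and> (\<forall>n. \<not> enat n \<le> s \<longrightarrow> f $ n = 0)"
proof -
  have "f \<in> series s \<longleftrightarrow> (\<forall>n. \<not> enat n \<le> s \<longrightarrow> f $ n = 0)"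
    by (auto simp: series_def fps_eq_iff trunc_nth)
  moreover have "f \<noteq> 0 \<and> subdegree f = 1 \<longleftrightarrow> f $ 0 = 0 \<and> f $ 1 \<noteq> 0"
  proof
    assume f: "f \<noteq> 0 \<and> subdegree f = 1"
    then have "f \<noteq> 0"
      by simp
    then have "f $ subdegree f \<noteq> 0"
      by (rule nth_subdegree_nonzero)
    moreover have "f $ 0 = 0"
      by (rule nth_less_subdegree_zero) (simp add: f)
    ultimately show "f $ 0 = 0 \<and> f $ 1 \<noteq> 0"
      using f by simp
  next
    assume f: "f $ 0 = 0 \<and> f $ 1 \<noteq> 0"
    then have "subdegree f = 1"
      by (intro subdegreeI) auto
    with f show "f \<noteq> 0 \<and> subdegree f = 1"
      by auto
  qed
  ultimately show ?thesis
    by (auto simp: Gamma_def)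
qed

lemma Gamma1D:
  assumes "H \<in> Gamma1 s"
  shows "H $ 0 = 0" "H $ 1 = 1" "1 \<le> s"
proof -
  have H: "H \<in> carrier (Gamma s)" "fps_X ^ 2 dvd H - fps_X"
    using assms by (auto simp: Gamma1_def)
  then obtain g where g: "H - fps_X = fps_X ^ 2 * g"
    by (auto simp: dvd_def)
  show "H $ 0 = 0"
    using H by (simp add: Gamma_iff)
  have "(H - fps_X) $ 1 = 0"
    unfolding g by (simp add: fps_X_power_mult_nth)
  then show "H $ 1 = 1"
    by simp
  then show "1 \<le> s"
    using H(1) unfolding Gamma_iff one_enat_def by (metis zero_neq_one)
qed

section \<open>The equation as a recursion for the coefficients\<close>

lemma of_nat_minus_1_nonzero:
  assumes "2 \<le> n"
  shows "of_nat n - 1 \<noteq> (0::'a::ring_char_0)"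
  using assms of_nat_eq_iff[of n 1, where ?'a = 'a] by auto

lemma sum_split_ends:
  fixes g :: "nat \<Rightarrow> 'a::comm_monoid_add"
  assumes "2 \<le> n"
  shows "(\<Sum>i=0..n. g i) = g 0 + g 1 + (\<Sum>i=2..n-1. g i) + g n"
proof -
  obtain m where m: "n = Suc (Suc m)"
    using assms by (metis add_2_eq_Suc le_Suc_ex)
  have "(\<Sum>i=0..n. g i) = (\<Sum>i=0..Suc m. g i) + g n"
    by (simp add: m)
  also have "(\<Sum>i=0..Suc m. g i) = g 0 + (g 1 + (\<Sum>i=2..Suc m. g i))"
    by (subst sum.atLeast_Suc_atMost, simp, subst sum.atLeast_Suc_atMost)
       (simp_all add: numeral_2_eq_2)
  finally show ?thesis
    by (simp add: m add_ac)
qed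

text \<open>
  Comparing coefficients: the summands \<open>i = 1\<close> on both sides contribute \<open>\<phi>\<^sub>n\<close> and \<open>n \<phi>\<^sub>n\<close>, the
  summands \<open>i = n\<close> contribute \<open>h\<^sub>n c\<^sup>n\<close> and \<open>h\<^sub>n c\<close>, and these are collected apart from the rest.
\<close>

lemma AJ_iff_recursion:
  fixes H \<Phi> :: "'a::field_char_0 fps"
  assumes "H \<in> Gamma1 s" "\<Phi> $ 0 = 0"
  shows "AJ s H \<Phi> \<longleftrightarrow> (\<forall>n. 2 \<le> n \<and> enat n \<le> s \<longrightarrow>
    (of_nat n - 1) * \<Phi> $ n = H $ n * ((\<Phi> $ 1) ^ n - \<Phi> $ 1)
      + (\<Sum>i=2..n-1. H $ i * (\<Phi> ^ i) $ n)
      - (\<Sum>i=2..n-1. H $ i * of_nat (n - i + 1) * \<Phi> $ (n - i + 1)))"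
proof -
  note H = Gamma1D[OF assms(1)]
  have L: "(H oo \<Phi>) $ n = \<Phi> $ n + (\<Sum>i=2..n-1. H $ i * (\<Phi> ^ i) $ n) + H $ n * (\<Phi> $ 1) ^ n"
    if "2 \<le> n" for n
    unfolding fps_compose_nth sum_split_ends[OF that]
    using H assms(2) by (simp add: startsby_zero_power_nth_same)
  have R: "(fps_deriv \<Phi> * H) $ n = of_nat n * \<Phi> $ n
      + (\<Sum>i=2..n-1. H $ i * of_nat (n - i + 1) * \<Phi> $ (n - i + 1)) + H $ n * \<Phi> $ 1"
    if "2 \<le> n" for n
    unfolding mult.commute[of "fps_deriv \<Phi>"] fps_mult_nth sum_split_ends[OF that]
    using H that by (simp add: mult_ac)
  have 0: "(H oo \<Phi>) $ n = (fps_deriv \<Phi> * H) $ n" if "n < 2" for n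
    using that H assms(2) by (cases n) (auto simp: fps_compose_nth fps_mult_nth less_Suc_eq)
  have eq: "(H oo \<Phi>) $ n = (fps_deriv \<Phi> * H) $ n \<longleftrightarrow>
      (of_nat n - 1) * \<Phi> $ n = H $ n * ((\<Phi> $ 1) ^ n - \<Phi> $ 1)
      + (\<Sum>i=2..n-1. H $ i * (\<Phi> ^ i) $ n)
      - (\<Sum>i=2..n-1. H $ i * of_nat (n - i + 1) * \<Phi> $ (n - i + 1))" if "2 \<le> n" for n
    unfolding L[OF that] R[OF that] by (simp only: algebra_simps) (auto simp: algebra_simps)
  show ?thesis
    unfolding AJ_def trunc_eq_iff using eq 0 by (meson not_le)
qed

text \<open>
  In the recursion, \<open>\<Phi>\<^sup>i\<close> with \<open>2 \<le> i\<close> contributes to degree \<open>n\<close> only coefficients of \<open>\<Phi>\<close> below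
  \<open>n\<close>, by \<open>U_eq_0\<close>. So two solutions that agree below \<open>n\<close> agree at \<open>n\<close>.
\<close>

lemma AJ_solution_unique:
  fixes H :: "'a::field_char_0 fps"
  assumes "H \<in> Gamma1 s" "\<Phi> \<in> AJ_solutions s H" "\<Psi> \<in> AJ_solutions s H" "\<Phi> $ 1 = \<Psi> $ 1"
  shows "\<Phi> = \<Psi>"
proof -
  have G: "\<Phi> \<in> carrier (Gamma s)" "\<Psi> \<in> carrier (Gamma s)" "AJ s H \<Phi>" "AJ s H \<Psi>"
    using assms by (auto simp: AJ_solutions_def)
  then have z: "\<Phi> $ 0 = 0" "\<Psi> $ 0 = 0"
    by (auto simp: Gamma_iff)
  have "\<Phi> $ n = \<Psi> $ n" for n
  proof (induction n rule: less_induct)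
    case (less n)
    consider "n = 0" | "n = 1" | "2 \<le> n" "\<not> enat n \<le> s" | "2 \<le> n" "enat n \<le> s"
      by linarith
    then show ?case
    proof cases
      case 3
      then show ?thesis
        using G by (simp add: Gamma_iff)
    next
      case 4
      have pow: "(\<Phi> ^ i) $ n = (\<Psi> ^ i) $ n" if "i \<in> {2..n-1}" for i
        unfolding fps_power_nth_multinomial[OF z(1)] fps_power_nth_multinomial[OF z(2)]
      proof (intro sum.cong refl arg_cong2[where f = "(*)"] prod.cong)
        fix u j assume "u \<in> U n i" "j \<in> {1..n}"
        then show "(\<Phi> $ j) ^ u j = (\<Psi> $ j) ^ u j"
          using that less U_eq_0[of u n i j] by (cases "j = n") auto
      qed
      then have high: "(\<Sum>i=2..n-1. H $ i * (\<Phi> ^ i) $ n) = (\<Sum>i=2..n-1. H $ i * (\<Psi> ^ i) $ n)"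
        by (intro sum.cong) auto
      have "\<Phi> $ (n - i + 1) = \<Psi> $ (n - i + 1)" if "i \<in> {2..n-1}" for i
        by (rule less) (use that in auto)
      then have low: "(\<Sum>i=2..n-1. H $ i * of_nat (n - i + 1) * \<Phi> $ (n - i + 1)) =
          (\<Sum>i=2..n-1. H $ i * of_nat (n - i + 1) * \<Psi> $ (n - i + 1))"
        by (intro sum.cong) auto
      have "(of_nat n - 1) * \<Phi> $ n = (of_nat n - 1) * \<Psi> $ n"
        using G(3)[unfolded AJ_iff_recursion[OF assms(1) z(1)], rule_format, OF conjI[OF 4]]
          G(4)[unfolded AJ_iff_recursion[OF assms(1) z(2)], rule_format, OF conjI[OF 4]]
        by (simp only: high low assms(4))
      moreover have "of_nat n - 1 \<noteq> (0::'a)"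
        by (rule of_nat_minus_1_nonzero[OF 4(1)])
      ultimately show ?thesis
        by simp
    qed (use z assms in auto)
  qed
  then show ?thesis
    by (simp add: fps_eq_iff)
qed

lemma K_at_rec:
  fixes c :: "'a::field_char_0"
  assumes "2 \<le> n"
  shows "(of_nat n - 1) * K_at n c h = h n * (\<Sum>j=0..n-2. c ^ j)
       + (\<Sum>i=2..n-1. h i * (\<Sum>u\<in>U n i. of_rat (B n i u) * c ^ u 1 * (c ^ 2 - c) ^ (i - u 1 - 1) *
               (\<Prod>j=2..n-i+1. K_at j c h ^ u j)))
       - (\<Sum>i=2..n-1. h i * of_nat (n - i + 1) * K_at (n - i + 1) c h)"
proof -
  have ne: "of_nat n - 1 \<noteq> (0::'a)"
    by (rule of_nat_minus_1_nonzero[OF assms])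
  show ?thesis
    unfolding K_at_def
    by (subst K.simps) (use assms ne in \<open>simp add: eval_upoly_hom of_rat_divide of_rat_diff del: of_nat_add of_nat_Suc prod.cl_ivl_Suc\<close>)
qed

text \<open>
  Each of the \<open>i - u\<^sub>1\<close> factors of index \<open>j \<ge> 2\<close> in the multinomial expansion brings a factor
  \<open>c\<^sup>2 - c\<close>. Since \<open>i < n\<close>, there is at least one of them, and one is pulled out of the sum.
\<close>

lemma Phi_power_nth:
  fixes c :: "'a::field_char_0"
  assumes "2 \<le> i" "i < n" "enat n \<le> s"
  shows "(Phi s H c ^ i) $ n = (c ^ 2 - c) * (\<Sum>u\<in>U n i. of_rat (B n i u) * c ^ u 1 *
    (c ^ 2 - c) ^ (i - u 1 - 1) * (\<Prod>j=2..n-i+1. K_at j c (fps_nth H) ^ u j))"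
proof -
  let ?d = "c ^ 2 - c" and ?k = "\<lambda>j. K_at j c (fps_nth H)"
  have Phi: "Phi s H c $ j = ?d * ?k j" if "j \<in> {2..n}" for j
    using that assms(3) by (auto simp: Phi_def intro: order_trans[rotated])
  have "(\<Prod>j=1..n. (Phi s H c $ j) ^ u j) =
      ?d * (c ^ u 1 * ?d ^ (i - u 1 - 1) * (\<Prod>j=2..n-i+1. ?k j ^ u j))" if u: "u \<in> U n i" for u
  proof -
    have n: "{1..n} = insert 1 {2..n}"
      using assms by auto
    have "(\<Prod>j=1..n. (Phi s H c $ j) ^ u j) = c ^ u 1 * (\<Prod>j=2..n. (?d * ?k j) ^ u j)"
      unfolding n using Phi by (simp add: Phi_def[of s H c])
    also have "(\<Prod>j=2..n. (?d * ?k j) ^ u j) = ?d ^ (\<Sum>j=2..n. u j) * (\<Prod>j=2..n. ?k j ^ u j)"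
      by (simp add: power_mult_distrib prod.distrib power_sum)
    also have "(\<Prod>j=2..n. ?k j ^ u j) = (\<Prod>j=2..n-i+1. ?k j ^ u j)"
      by (rule prod.mono_neutral_right) (use assms U_eq_0[OF u] in auto)
    also have "(\<Sum>j=2..n. u j) = Suc (i - u 1 - 1)"
      using U_sum_head(1)[OF u] U_first_less[OF u] assms by simp
    finally show ?thesis
      by (simp add: mult_ac)
  qed
  moreover have "Phi s H c $ 0 = 0"
    by (simp add: Phi_def)
  ultimately show ?thesis
    by (simp add: fps_power_nth_multinomial sum_distrib_left mult_ac)
qed

text \<open>
  The recursion for the coefficients of a solution is \<open>c\<^sup>2 - c\<close> times the one that defines \<open>K n\<close>.
\<close>

lemma Phi_solution:
  fixes H :: "'a::field_char_0 fps"
  assumes H: "H \<in> Gamma1 s" and "c \<noteq> 0"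
  shows "Phi s H c \<in> AJ_solutions s H"
proof -
  let ?d = "c ^ 2 - c" and ?k = "\<lambda>j. K_at j c (fps_nth H)"
  have G: "Phi s H c \<in> carrier (Gamma s)"
    using \<open>c \<noteq> 0\<close> Gamma1D(3)[OF H] by (auto simp: Gamma_iff Phi_def one_enat_def)
  have "AJ s H (Phi s H c)"
  proof (subst AJ_iff_recursion[OF H], goal_cases)
    case 2
    show ?case
    proof (intro allI impI, elim conjE)
      fix n :: nat assume n: "2 \<le> n" "enat n \<le> s"
      have Phi: "Phi s H c $ j = ?d * ?k j" if "j \<in> {2..n}" for j
        using that n by (auto simp: Phi_def intro: order_trans[rotated])
      have geom: "c ^ n - c = ?d * (\<Sum>j=0..n-2. c ^ j)"
      proof -
        obtain m where m: "n = Suc (Suc m)"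
          using n by (metis add_2_eq_Suc le_Suc_ex)
        have "c ^ Suc m - 1 = (c - 1) * (\<Sum>j=0..m. c ^ j)"
          by (metis atLeast0AtMost lessThan_Suc_atMost power_diff_1_eq)
        then have "c * (c ^ Suc m - 1) = c * ((c - 1) * (\<Sum>j=0..m. c ^ j))"
          by simp
        then show ?thesis
          by (simp add: m power2_eq_square left_diff_distrib right_diff_distrib mult.assoc)
      qed
      have "(of_nat n - 1) * Phi s H c $ n = ?d * ((of_nat n - 1) * ?k n)"
        using n by (simp add: Phi)
      also have "\<dots> = H $ n * (c ^ n - c) + (\<Sum>i=2..n-1. H $ i * (Phi s H c ^ i) $ n)
          - (\<Sum>i=2..n-1. H $ i * of_nat (n - i + 1) * Phi s H c $ (n - i + 1))"
      proof -
        have "(\<Sum>i=2..n-1. H $ i * (Phi s H c ^ i) $ n) = ?d * (\<Sum>i=2..n-1. H $ i *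
            (\<Sum>u\<in>U n i. of_rat (B n i u) * c ^ u 1 * ?d ^ (i - u 1 - 1) *
               (\<Prod>j=2..n-i+1. ?k j ^ u j)))"
          unfolding sum_distrib_left[of ?d]
        proof (intro sum.cong refl, goal_cases)
          case (1 i)
          then have i: "2 \<le> i" "i < n"
            using n by auto
          show ?case
            unfolding Phi_power_nth[OF i n(2)] by (simp only: mult.left_commute)
        qed
        moreover have "(\<Sum>i=2..n-1. H $ i * of_nat (n - i + 1) * Phi s H c $ (n - i + 1)) =
            ?d * (\<Sum>i=2..n-1. H $ i * of_nat (n - i + 1) * ?k (n - i + 1))"
          unfolding sum_distrib_left[of ?d]
        proof (intro sum.cong refl, goal_cases)
          case (1 i)
          then have "n - i + 1 \<in> {2..n}"
            using n by auto
          then show ?case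
            by (simp only: Phi mult.left_commute)
        qed
        ultimately show ?thesis
          unfolding K_at_rec[OF n(1)] geom by (simp only: ring_distribs mult_ac)
      qed
      finally show "(of_nat n - 1) * Phi s H c $ n =
          H $ n * ((Phi s H c $ 1) ^ n - Phi s H c $ 1) + (\<Sum>i=2..n-1. H $ i * (Phi s H c ^ i) $ n)
          - (\<Sum>i=2..n-1. H $ i * of_nat (n - i + 1) * Phi s H c $ (n - i + 1))"
        by (simp add: Phi_def[of s H c])
    qed
  qed (simp add: Phi_def)
  with G show ?thesis
    by (simp add: AJ_solutions_def)
qed

section \<open>The group of solutions\<close>

text \<open>
  Modulo truncation,
  \<open>H \<circ> \<Phi> \<circ> \<Psi> = (\<Phi>' H) \<circ> \<Psi> = (\<Phi>' \<circ> \<Psi>) (H \<circ> \<Psi>) = (\<Phi>' \<circ> \<Psi>) \<Psi>' H = (\<Phi> \<circ> \<Psi>)' H\<close>.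
\<close>

lemma AJ_solutions_compose:
  fixes H :: "'a::field_char_0 fps"
  assumes H: "H \<in> Gamma1 s" and "\<Phi> \<in> AJ_solutions s H" "\<Psi> \<in> AJ_solutions s H"
  shows "trunc s (\<Phi> oo \<Psi>) \<in> AJ_solutions s H"
    and "trunc s (\<Phi> oo \<Psi>) $ 1 = \<Phi> $ 1 * \<Psi> $ 1"
proof -
  note H' = Gamma1D[OF H]
  have AJ: "AJ s H \<Phi>" "AJ s H \<Psi>" and z: "\<Phi> $ 0 = 0" "\<Psi> $ 0 = 0" "\<Phi> $ 1 \<noteq> 0" "\<Psi> $ 1 \<noteq> 0"
    using assms(2,3) by (auto simp: AJ_solutions_def Gamma_iff)
  show lin: "trunc s (\<Phi> oo \<Psi>) $ 1 = \<Phi> $ 1 * \<Psi> $ 1"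
    using H'(3) z by (simp add: trunc_nth fps_compose_nth one_enat_def)
  have "trunc s (H oo trunc s (\<Phi> oo \<Psi>)) = trunc s (H oo (\<Phi> oo \<Psi>))"
    by (rule trunc_compose_cong) auto
  also have "\<dots> = trunc s ((H oo \<Phi>) oo \<Psi>)"
    using z by (simp add: fps_compose_assoc)
  also have "\<dots> = trunc s ((fps_deriv \<Phi> * H) oo \<Psi>)"
    by (rule trunc_compose_cong) (use AJ in \<open>auto simp: AJ_def\<close>)
  also have "\<dots> = trunc s ((fps_deriv \<Phi> oo \<Psi>) * (H oo \<Psi>))"
    using z by (simp add: fps_compose_mult_distrib)
  also have "\<dots> = trunc s ((fps_deriv \<Phi> oo \<Psi>) * (fps_deriv \<Psi> * H))"
    by (rule trunc_mult_cong) (use AJ in \<open>auto simp: AJ_def\<close>)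
  also have "\<dots> = trunc s (fps_deriv (\<Phi> oo \<Psi>) * H)"
    using z by (simp add: fps_compose_deriv mult_ac)
  also have "\<dots> = trunc s (fps_deriv (trunc s (\<Phi> oo \<Psi>)) * H)"
    by (rule trunc_deriv_mult_cong) (use H' in auto)
  finally have "AJ s H (trunc s (\<Phi> oo \<Psi>))"
    by (simp add: AJ_def)
  moreover have "trunc s (\<Phi> oo \<Psi>) \<in> carrier (Gamma s)"
    using lin z by (simp add: Gamma_iff trunc_nth fps_compose_nth)
  ultimately show "trunc s (\<Phi> oo \<Psi>) \<in> AJ_solutions s H"
    by (simp add: AJ_solutions_def)
qed

lemma Phi_nth_1 [simp]: "Phi s H c $ 1 = c" "Phi s H c $ Suc 0 = c"
  by (simp_all add: Phi_def)

lemma AJ_solutions_eq_image: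
  assumes "H \<in> Gamma1 s"
  shows "AJ_solutions s H = Phi s H ` (UNIV - {0})"
proof (intro equalityI subsetI)
  fix \<Psi> assume \<Psi>: "\<Psi> \<in> AJ_solutions s H"
  then have "\<Psi> $ 1 \<noteq> 0"
    by (simp add: AJ_solutions_def Gamma_iff)
  moreover from this have "\<Psi> = Phi s H (\<Psi> $ 1)"
    by (intro AJ_solution_unique[OF assms \<Psi> Phi_solution[OF assms]]) auto
  ultimately show "\<Psi> \<in> Phi s H ` (UNIV - {0})"
    by blast
qed (use Phi_solution[OF assms] in auto)

lemma comm_group_mult_group: "comm_group (mult_group :: 'a::field_char_0 monoid)"
  by (rule comm_groupI)
     (auto simp: mult_group_def mult_ac intro!: bexI[where x = "inverse x" for x])

text \<open>
  \<open>\<Phi>\<^sub>c \<circ> \<Phi>\<^sub>d\<close> and \<open>\<Phi>\<^sub>c\<^sub>d\<close> are solutions with the same linear coefficient, hence equal; the linear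
  coefficient also recovers \<open>c\<close> from \<open>\<Phi>\<^sub>c\<close>.
\<close>

lemma Phi_iso:
  assumes "H \<in> Gamma1 s"
  shows "Phi s H \<in> iso mult_group ((Gamma s) \<lparr>carrier := AJ_solutions s H\<rparr>)"
proof (rule isoI)
  have mult: "Phi s H (c * d) = trunc s (Phi s H c oo Phi s H d)" if "c \<noteq> 0" "d \<noteq> 0" for c d
    using AJ_solutions_compose[OF assms Phi_solution[OF assms that(1)] Phi_solution[OF assms that(2)]]
    by (intro AJ_solution_unique[OF assms Phi_solution[OF assms]]) (use that in auto)
  then show "Phi s H \<in> hom mult_group ((Gamma s) \<lparr>carrier := AJ_solutions s H\<rparr>)"
    using Phi_solution[OF assms] by (auto simp: hom_def mult_group_def Gamma_def)
  have "inj_on (Phi s H) (UNIV - {0})"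
    by (rule inj_onI) (metis Phi_nth_1(1))
  then show "bij_betw (Phi s H) (carrier mult_group) (carrier ((Gamma s) \<lparr>carrier := AJ_solutions s H\<rparr>))"
    by (simp add: bij_betw_def mult_group_def AJ_solutions_eq_image[OF assms])
qed

text \<open>
  At \<open>c = 1\<close> the factor \<open>c\<^sup>2 - c\<close> vanishes, so \<open>\<Phi>\<^sub>1 = x\<close>. The transported group structure has
  \<open>\<Phi>\<^sub>1\<close> as its unit, and this identifies it with the unit of \<open>Gamma s\<close>.
\<close>

lemma Phi_1:
  assumes "H \<in> Gamma1 s"
  shows "Phi s H 1 = \<one>\<^bsub>Gamma s\<^esub>"
  using Gamma1D(3)[OF assms]
  by (auto simp: Gamma_def fps_eq_iff Phi_def trunc_nth one_enat_def fps_X_def)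

lemma comm_group_AJ_solutions:
  assumes "H \<in> Gamma1 s"
  shows "comm_group ((Gamma s) \<lparr>carrier := AJ_solutions s H\<rparr>)"
  using comm_group.iso_imp_img_comm_group[OF comm_group_mult_group Phi_iso[OF assms]]
    Phi_1[OF assms]
  by (simp add: mult_group_def)

theorem theorem3:
  fixes s :: enat
  shows "(\<forall>n. 2 \<le> n \<and> enat n \<le> s \<longrightarrow>
            (\<forall>i\<in>{2..n-1}. \<forall>u\<in>U n i. u 1 + 1 \<le> i) \<and>
            K n \<in> poly_ring (insert Y (T ` {2..n})))
       \<and> (\<forall>H :: 'a::field_char_0 fps. H \<in> Gamma1 s \<longrightarrow>
            (\<forall>c. c \<noteq> 0 \<longrightarrow>
               Phi s H c \<in> AJ_solutions s H \<and>
               fps_nth (Phi s H c) 1 = c \<and>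
               (\<forall>\<Psi> \<in> AJ_solutions s H. fps_nth \<Psi> 1 = c \<longrightarrow> \<Psi> = Phi s H c)) \<and>
            AJ_solutions s H = Phi s H ` (UNIV - {0}) \<and>
            comm_group ((Gamma s) \<lparr>carrier := AJ_solutions s H\<rparr>) \<and>
            (Gamma s) \<lparr>carrier := AJ_solutions s H\<rparr> \<cong> (mult_group :: 'a monoid))"
proof (intro conjI allI impI ballI)
  fix n i u assume "2 \<le> n \<and> enat n \<le> s" "i \<in> {2..n-1}" "u \<in> U n i"
  then show "u 1 + 1 \<le> i"
    using U_first_less[of u n i] by fastforce
next
  fix n show "K n \<in> poly_ring (insert Y (T ` {2..n}))"
    by (rule K_in_poly_ring)
next
  fix H :: "'a fps" assume H: "H \<in> Gamma1 s"
  {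
    fix c :: 'a assume c: "c \<noteq> 0"
    show sol: "Phi s H c \<in> AJ_solutions s H"
      by (rule Phi_solution[OF H c])
    show "Phi s H c $ 1 = c"
      by simp
    show "\<Psi> = Phi s H c" if "\<Psi> \<in> AJ_solutions s H" "\<Psi> $ 1 = c" for \<Psi>
      by (rule AJ_solution_unique[OF H that(1) sol]) (use that in simp)
  }
  show "AJ_solutions s H = Phi s H ` (UNIV - {0})"
    by (rule AJ_solutions_eq_image[OF H])
  show "comm_group ((Gamma s) \<lparr>carrier := AJ_solutions s H\<rparr>)"
    by (rule comm_group_AJ_solutions[OF H])
  interpret comm_group "mult_group :: 'a monoid"
    by (rule comm_group_mult_group)
  show "(Gamma s) \<lparr>carrier := AJ_solutions s H\<rparr> \<cong> (mult_group :: 'a monoid)"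
    using iso_set_sym[OF Phi_iso[OF H]] by (auto simp: is_iso_def)
qed

end
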